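(* Let $d\ge 3$, $2\le \ell\le d$, $2\le a\le d$, and $1\le m\le\lfloor a/2\rfloor$. Let $P:=T_m^{d,d-a}$ be a $d$-polytope with at least $d+\ell$ facets, and suppose $P$ is not (combinatorially equivalent to) $T_1^{d,d-\ell}$. Then: (i) if $m=1$, then $f_k(P)>f_k(T_1^{d,d-\ell})$ for each $k\ge \ell-1$; (ii) if $m\ge 2$, then $f_k(P)>f_k(T_1^{d,d-\ell})$ for each $k\in\{1,\dots,d-2\}$.
   Context: $f_k(Q)$ denotes the number of $k$-faces of a polytope $Q$ (for a $d$-polytope, $0\le k\le d-1$). $T(j)$ is a $j$-simplex. For polytopes $Q\subset\mathbb{R}^p$, $Q'\subset\mathbb{R}^q$ with the origin in their relative interiors, $Q\oplus Q'$ is the convex hull of $\{(x,0):x\in Q\}\cup\{(0,y):y\in Q'\}$. $T_m^{d,d-a}$ denotes the $(d-a)$-fold pyramid over $T(m)\oplus T(a-m)$; it is a $d$-polytope with $d+2$ vertices and $d+1+m(a-m)$ facets. *)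

theory Defs
  imports "HOL-Analysis.Analysis"
begin

definition f_num :: "nat \<Rightarrow> 'a::euclidean_space set \<Rightarrow> nat" where
  "f_num k P = card {F. F face_of P \<and> aff_dim F = int k}"

text \<open>The face lattice contains the empty face and the polytope itself.\<close>

definition comb_equivalent ::
  "'a::euclidean_space set \<Rightarrow> 'b::euclidean_space set \<Rightarrow> bool" where
  "comb_equivalent P P' \<longleftrightarrow>
     (\<exists>\<phi>. bij_betw \<phi> {F. F face_of P} {G. G face_of P'} \<and>
          (\<forall>F G. F face_of P \<longrightarrow> G face_of P \<longrightarrow> (F \<subseteq> G \<longleftrightarrow> \<phi> F \<subseteq> \<phi> G)))"

definition free_sum ::
  "'p::euclidean_space set \<Rightarrow> 'q::euclidean_space set \<Rightarrow> ('p \<times> 'q) set" where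
  "free_sum Q Q' = convex hull ((\<lambda>x. (x, 0)) ` Q \<union> (\<lambda>y. (0, y)) ` Q')"

inductive iterated_pyramid ::
  "nat \<Rightarrow> 'a::euclidean_space set \<Rightarrow> 'a set \<Rightarrow> bool" where
  base: "iterated_pyramid 0 B B"
| apex: "iterated_pyramid r B P \<Longrightarrow> x \<notin> affine hull P \<Longrightarrow>
         iterated_pyramid (Suc r) B (convex hull (insert x P))"

text \<open>
  \<open>T_polytope d a m P\<close> says that \<open>P\<close> is a realization of the combinatorial type
  \<open>T\<^sub>m\<close> with superscript \<open>d, d - a\<close>. The simplices need not be full-dimensional in
  their spaces, so the apexes of the pyramids can be taken in the same product space as
  the sum; realizations exist as soon as the first factor has dimension at least \<open>m\<close>,
  the second at least \<open>a - m\<close>, and the product at least \<open>d\<close>.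
  The subtractions are meant for \<open>m \<le> a \<le> d\<close>.
\<close>

definition T_polytope ::
  "nat \<Rightarrow> nat \<Rightarrow> nat \<Rightarrow> ('p::euclidean_space \<times> 'q::euclidean_space) set \<Rightarrow> bool" where
  "T_polytope d a m P \<longleftrightarrow>
     (\<exists>(Q :: 'p set) (Q' :: 'q set).
        int m simplex Q \<and> int (a - m) simplex Q' \<and>
        0 \<in> rel_interior Q \<and> 0 \<in> rel_interior Q' \<and>
        iterated_pyramid (d - a) (free_sum Q Q') P)"

end

(* The d + 2 vertices of T_m^{d,d-a} carry, up to scaling, a single affine dependency w, which is
   positive on the m + 1 vertices of T(m), negative on the a - m + 1 vertices of T(a-m) and zero on
   the apexes. A set S of vertices spans a face iff S contains either both or neither of the
   supports Pos and Neg of w: a point common to aff S and to the hull of the remaining vertices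
   would give a multiple of w that is nonnegative off S, while the Radon point, interior to both
   conv Pos and conv Neg, lies in any face that contains one of them. Complementing S and using
   inclusion-exclusion, with n = d + 1 and j = d + 1 - k,
     f_k = C(n+1,j) + C(n-a,j) - C(n-m,j) - C(n-(a-m),j),
   and the number of facets is d + 1 + m(a-m). So both claims are inequalities of binomial
   coefficients. For m = 1 monotonicity suffices. For m >= 2 one uses l <= 1 + m(a-m) and induction
   on m; each step is an instance of the convexity of x |-> C(x,r). *)
theory Submission
  imports Defs
begin

section \<open>Point sets with a one-dimensional space of affine dependencies, and the faces of
  their hulls\<close>

definition pos_support :: "'a set \<Rightarrow> ('a \<Rightarrow> real) \<Rightarrow> 'a set" where
  "pos_support V w = {v \<in> V. 0 < w v}"

text \<open>The support of \<open>w\<close> is a circuit of the affine matroid of \<open>V\<close>.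
  Zeros of \<open>w\<close> are allowed, so that apexes of pyramids can belong to
  \<open>V\<close>.\<close>

locale affine_circuit =
  fixes V :: "'a::euclidean_space set" and w :: "'a \<Rightarrow> real"
  assumes finite_V: "finite V"
    and sum_w: "sum w V = 0"
    and comb_w: "(\<Sum>v\<in>V. w v *\<^sub>R v) = 0"
    and nontrivial: "\<exists>v\<in>V. w v \<noteq> 0"
    and dependency_unique:
      "\<And>c. sum c V = 0 \<Longrightarrow> (\<Sum>v\<in>V. c v *\<^sub>R v) = 0 \<Longrightarrow> \<exists>t. \<forall>v\<in>V. c v = t * w v"

text \<open>Negating \<open>w\<close> swaps the positive and the negative support, so what is proved
  for one transfers to the other.\<close>

lemma affine_circuit_uminus:
  assumes "affine_circuit V w"
  shows "affine_circuit V (\<lambda>v. - w v)"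
proof -
  interpret affine_circuit V w by fact
  show ?thesis
  proof
    fix c assume "sum c V = 0" "(\<Sum>v\<in>V. c v *\<^sub>R v) = 0"
    then obtain t where "\<forall>v\<in>V. c v = t * w v" using dependency_unique by blast
    then have "\<forall>v\<in>V. c v = (- t) * (- w v)" by simp
    then show "\<exists>t. \<forall>v\<in>V. c v = t * - w v" by blast
  qed (use finite_V sum_w comb_w nontrivial in \<open>auto simp: sum_negf\<close>)
qed

context affine_circuit
begin

abbreviation Pos where "Pos \<equiv> pos_support V w"
abbreviation Neg where "Neg \<equiv> pos_support V (\<lambda>v. - w v)"

definition face_sets :: "'a set set" where
  "face_sets = {S. S \<subseteq> V \<and> (Pos \<subseteq> S \<longleftrightarrow> Neg \<subseteq> S)}"

lemma Pos_Neg_subset: "Pos \<subseteq> V" "Neg \<subseteq> V" "Pos \<inter> Neg = {}"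
  by (auto simp: pos_support_def)

lemma Neg_nonempty: "Neg \<noteq> {}"
proof
  assume "Neg = {}"
  then have "\<forall>v\<in>V. 0 \<le> w v" by (force simp: pos_support_def)
  then have "\<forall>v\<in>V. w v = 0"
    using sum_w finite_V by (simp add: sum_nonneg_eq_0_iff)
  then show False using nontrivial by blast
qed

lemma Pos_nonempty: "Pos \<noteq> {}"
  using affine_circuit.Neg_nonempty[OF affine_circuit_uminus[OF affine_circuit_axioms]]
  by simp

text \<open>A dependency on \<open>S\<close>, extended by zero, is a multiple of \<open>w\<close>.
  It vanishes at \<open>v\<close>, where \<open>w\<close> does not, so the multiple is zero.\<close>

lemma affine_independent_if_missing:
  assumes "S \<subseteq> V" "v \<in> V" "w v \<noteq> 0" "v \<notin> S"
  shows "\<not> affine_dependent S"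
proof
  have fin: "finite S" using assms(1) finite_V finite_subset by blast
  assume "affine_dependent S"
  then obtain U where U: "sum U S = 0" "(\<Sum>x\<in>S. U x *\<^sub>R x) = 0" and ne: "\<exists>x\<in>S. U x \<noteq> 0"
    by (auto simp: affine_dependent_explicit_finite[OF fin])
  define c where "c x = (if x \<in> S then U x else 0)" for x
  have "sum c V = sum U S"
    unfolding c_def using finite_V assms(1) by (simp add: sum.If_cases Int_absorb1)
  moreover have "(\<Sum>x\<in>V. c x *\<^sub>R x) = (\<Sum>x\<in>S. U x *\<^sub>R x)"
    using finite_V assms(1) by (intro sum.mono_neutral_cong_right) (auto simp: c_def)
  ultimately obtain t where t: "\<forall>x\<in>V. c x = t * w x"
    using dependency_unique U by metis
  then have "t = 0" using assms by (auto simp: c_def)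
  then show False using ne t assms(1) by (auto simp: c_def split: if_splits)
qed

text \<open>This disjointness is the criterion by which the hull of \<open>S\<close> is recognized
  as a face of the hull of \<open>V\<close>.\<close>

lemma face_sets_disjoint_hulls:
  assumes S: "S \<in> face_sets"
  shows "affine hull S \<inter> convex hull (V - S) = {}"
proof (rule ccontr)
  have SV: "S \<subseteq> V" and finS: "finite S" and fin': "finite (V - S)"
    using S finite_V finite_subset by (auto simp: face_sets_def)
  assume "affine hull S \<inter> convex hull (V - S) \<noteq> {}"
  then obtain x where "x \<in> affine hull S" "x \<in> convex hull (V - S)" by blast
  then obtain f g where f: "sum f S = 1" "(\<Sum>v\<in>S. f v *\<^sub>R v) = x"
    and g: "\<forall>v\<in>V - S. 0 \<le> g v" "sum g (V - S) = 1" "(\<Sum>v\<in>V - S. g v *\<^sub>R v) = x"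
    by (auto simp: affine_hull_finite[OF finS] convex_hull_finite[OF fin'])
  \<comment> \<open>The difference of the two representations of \<open>x\<close> is an affine
    dependency, and off \<open>S\<close> it agrees with the nonnegative \<open>g\<close>.\<close>
  define c where "c v = (if v \<in> S then - f v else g v)" for v
  have "sum c V = sum g (V - S) + (\<Sum>v\<in>S. - f v)"
    unfolding sum.subset_diff[OF SV finite_V] by (simp add: c_def)
  moreover have "(\<Sum>v\<in>V. c v *\<^sub>R v) = (\<Sum>v\<in>V - S. g v *\<^sub>R v) + (\<Sum>v\<in>S. - f v *\<^sub>R v)"
    unfolding sum.subset_diff[OF SV finite_V] by (simp add: c_def)
  ultimately have "sum c V = 0" "(\<Sum>v\<in>V. c v *\<^sub>R v) = 0"
    using f g by (simp_all add: sum_negf)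
  then obtain t where t: "\<And>v. v \<in> V \<Longrightarrow> c v = t * w v"
    using dependency_unique by blast
  have outside: "0 \<le> t * w v" if "v \<in> V - S" for v
    using t[of v] bspec[OF g(1) that] that by (simp add: c_def)
  \<comment> \<open>The point \<open>u\<close> excludes \<open>t = 0\<close> and lies in the support
    whose sign is that of \<open>t\<close>. That support is not contained in \<open>S\<close>,
    whereas nonnegativity off \<open>S\<close> forces the other one into \<open>S\<close>.\<close>
  obtain u where u: "u \<in> V - S" "g u > 0"
    using g by (metis less_eq_real_def sum.neutral zero_neq_one)
  then have tu: "0 < t * w u" using t[of u] by (auto simp: c_def)
  consider "t > 0" "w u > 0" | "t < 0" "w u < 0"
    using tu by (auto simp: zero_less_mult_iff)
  then show False
  proof cases
    case 1
    have "Neg \<subseteq> S" using outside 1(1) by (force simp: pos_support_def zero_le_mult_iff)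
    moreover have "\<not> Pos \<subseteq> S" using u 1 by (auto simp: pos_support_def)
    ultimately show False using S by (auto simp: face_sets_def)
  next
    case 2
    have "Pos \<subseteq> S" using outside 2(1) by (force simp: pos_support_def zero_le_mult_iff)
    moreover have "\<not> Neg \<subseteq> S" using u 2 by (auto simp: pos_support_def)
    ultimately show False using S by (auto simp: face_sets_def)
  qed
qed

text \<open>\<open>S\<close> can be read off from its hull, so passing to hulls is injective on
  \<open>face_sets\<close> and reflects inclusion.\<close>

lemma face_sets_vertices:
  assumes "S \<in> face_sets"
  shows "V \<inter> convex hull S = S"
proof -
  have "convex hull S \<inter> convex hull (V - S) = {}"
    using face_sets_disjoint_hulls[OF assms] convex_hull_subset_affine_hull by blast
  moreover have "V - S \<subseteq> convex hull (V - S)" "S \<subseteq> convex hull S" by (rule hull_subset)+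
  ultimately show ?thesis using assms by (auto simp: face_sets_def)
qed

lemma Pos_subset_face_imp_Neg:
  assumes F: "F face_of convex hull V" and "Pos \<subseteq> F"
  shows "Neg \<subseteq> F"
proof -
  have finP: "finite Pos" "finite Neg"
    using finite_V Pos_Neg_subset finite_subset by blast+
  define s where "s = sum w Pos"
  have spos: "s > 0"
    unfolding s_def using Pos_nonempty finP by (intro sum_pos) (auto simp: pos_support_def)
  have split: "sum f V = sum f Pos + sum f Neg" if "\<And>v. w v = 0 \<Longrightarrow> f v = 0" for f :: "'a \<Rightarrow> 'b::real_vector"
  proof -
    have "sum f V = sum f (Pos \<union> Neg)"
      using that Pos_Neg_subset
      by (intro sum.mono_neutral_right[OF finite_V]) (force simp: pos_support_def)+
    then show ?thesis using finP Pos_Neg_subset(3) by (simp add: sum.union_disjoint)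
  qed
  have sN: "sum w Neg = - s"
    using split[of w] sum_w by (simp add: s_def)
  have cN: "(\<Sum>v\<in>Pos. w v *\<^sub>R v) = - (\<Sum>v\<in>Neg. w v *\<^sub>R v)"
    using split[of "\<lambda>v. w v *\<^sub>R v"] comb_w by (simp add: eq_neg_iff_add_eq_0)
  \<comment> \<open>The Radon point: dividing by the total positive weight \<open>s\<close> makes
    the coefficients on \<open>Pos\<close> convex. Because \<open>sum w Neg = - s\<close>, the same
    scaling gives a convex combination of \<open>Neg\<close>.\<close>
  define p where "p = (\<Sum>v\<in>Pos. (w v / s) *\<^sub>R v)"
  have "p \<in> convex hull Pos"
    unfolding convex_hull_finite[OF finP(1)] p_def using spos
    by (auto intro!: exI[of _ "\<lambda>v. w v / s"] simp: pos_support_def s_def simp flip: sum_divide_distrib)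
  then have pF: "p \<in> F"
    using hull_minimal[OF assms(2), of convex] face_of_imp_convex[OF F] by blast
  have "(1 / s) *\<^sub>R (\<Sum>v\<in>Pos. w v *\<^sub>R v) = (1 / s) *\<^sub>R - (\<Sum>v\<in>Neg. w v *\<^sub>R v)" using cN by simp
  then have pN: "p = (\<Sum>v\<in>Neg. (- w v / s) *\<^sub>R v)"
    by (simp add: p_def scaleR_sum_right sum_negf)
  \<comment> \<open>All coefficients on \<open>Neg\<close> are strictly positive. A face that meets
    the relative interior of a convex subset contains that subset.\<close>
  have "p \<in> rel_interior (convex hull Neg)"
    using spos sN pN
    by (intro subsetD[OF explicit_subset_rel_interior_convex_hull_minimal[OF finP(2)]])
      (auto intro!: exI[of _ "\<lambda>v. - w v / s"] simp: pos_support_def divide_neg_pos sum_negf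
             simp flip: sum_divide_distrib)
  moreover have "convex hull Neg \<subseteq> convex hull V"
    by (rule hull_mono) (rule Pos_Neg_subset)
  ultimately have "convex hull Neg \<subseteq> F"
    using subset_of_face_of[OF F] pF by blast
  then show ?thesis using hull_subset[of Neg convex] by blast
qed

lemma Pos_subset_face_iff_Neg:
  assumes "F face_of convex hull V"
  shows "Pos \<subseteq> F \<longleftrightarrow> Neg \<subseteq> F"
  using Pos_subset_face_imp_Neg[OF assms]
    affine_circuit.Pos_subset_face_imp_Neg[OF affine_circuit_uminus[OF affine_circuit_axioms] assms]
  by auto

lemma faces_eq: "{F. F face_of convex hull V} = (\<lambda>S. convex hull S) ` face_sets"
proof (intro equalityI subsetI)
  fix F assume "F \<in> {F. F face_of convex hull V}"
  then have F: "F face_of convex hull V" by simp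
  obtain S' where S': "S' \<subseteq> V" "F = convex hull S'"
    using face_of_convex_hull_subset[OF finite_imp_compact[OF finite_V] F] by blast
  \<comment> \<open>\<open>S'\<close> may omit points of \<open>V\<close> that lie in
    \<open>F\<close>, so it is enlarged to \<open>V \<inter> F\<close>, to which the condition on
    the supports applies.\<close>
  have "S' \<subseteq> F" using S'(2) hull_subset[of S'] by simp
  then have "convex hull S' \<subseteq> convex hull (V \<inter> F)" using S'(1) by (intro hull_mono) blast
  moreover have "convex hull (V \<inter> F) \<subseteq> F"
    by (rule hull_minimal) (use face_of_imp_convex[OF F] in auto)
  ultimately have "F = convex hull (V \<inter> F)" using S'(2) by blast
  moreover have "V \<inter> F \<in> face_sets"
    using Pos_subset_face_iff_Neg[OF F] Pos_Neg_subset by (auto simp: face_sets_def)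
  ultimately show "F \<in> (\<lambda>S. convex hull S) ` face_sets" by blast
next
  fix F assume "F \<in> (\<lambda>S. convex hull S) ` face_sets"
  then obtain S where S: "S \<in> face_sets" "F = convex hull S" by blast
  then show "F \<in> {F. F face_of convex hull V}"
    using face_of_convex_hulls[OF finite_V _ face_sets_disjoint_hulls[OF S(1)]]
    by (auto simp: face_sets_def)
qed

lemma inj_on_hull: "inj_on (\<lambda>S. convex hull S) face_sets"
  by (rule inj_on_inverseI[where g = "\<lambda>F. V \<inter> F"]) (rule face_sets_vertices)

lemma hull_subset_iff:
  assumes "S \<in> face_sets" "T \<in> face_sets"
  shows "convex hull S \<subseteq> convex hull T \<longleftrightarrow> S \<subseteq> T"
  using face_sets_vertices[OF assms(1)] face_sets_vertices[OF assms(2)] hull_mono[of S T convex]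
  by blast

text \<open>Without all of \<open>Pos\<close> the set \<open>S\<close> is affinely independent. With
  both supports it carries exactly one dependency up to scaling, which costs one further
  dimension.\<close>

lemma aff_dim_face:
  assumes "S \<in> face_sets"
  shows "aff_dim (convex hull S) = int (card S) - (if Pos \<subseteq> S then 2 else 1)"
proof (cases "Pos \<subseteq> S")
  case False
  then obtain v where "v \<in> V" "w v \<noteq> 0" "v \<notin> S" by (force simp: pos_support_def)
  then have "\<not> affine_dependent S"
    using assms affine_independent_if_missing by (auto simp: face_sets_def)
  then show ?thesis
    using False aff_dim_affine_independent[of S] by (simp add: aff_dim_convex_hull)
next
  case True
  then have SV: "S \<subseteq> V" and both: "Pos \<subseteq> S" "Neg \<subseteq> S" using assms by (auto simp: face_sets_def)
  have finS: "finite S" using SV finite_V finite_subset by blast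
  obtain v where v: "v \<in> Pos" using Pos_nonempty by blast
  then have v': "v \<in> S" "v \<in> V" "w v \<noteq> 0" using both by (auto simp: pos_support_def)
  have "\<not> affine_dependent (S - {v})"
    using affine_independent_if_missing[of "S - {v}" v] v' SV by auto
  then have d: "int (card (S - {v})) = aff_dim (S - {v}) + 1"
    by (rule aff_dim_affine_independent)
  have zero: "w x = 0" if "x \<in> V - S" for x
    using that both by (force simp: pos_support_def)
  have "sum w S = 0" "(\<Sum>x\<in>S. w x *\<^sub>R x) = 0"
    using sum.mono_neutral_right[OF finite_V SV, of w] sum_w
      sum.mono_neutral_right[OF finite_V SV, of "\<lambda>x. w x *\<^sub>R x"] comb_w zero by auto
  then have s: "sum w (S - {v}) = - w v" "(\<Sum>x\<in>S - {v}. w x *\<^sub>R x) = - w v *\<^sub>R v"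
    using sum.remove[OF finS v'(1), of w] sum.remove[OF finS v'(1), of "\<lambda>x. w x *\<^sub>R x"]
    by (auto simp: add_eq_0_iff)
  \<comment> \<open>The dependency is solved for \<open>v\<close>, so deleting \<open>v\<close> from
    \<open>S\<close> leaves the affine hull unchanged.\<close>
  have "(- 1 / w v) *\<^sub>R (\<Sum>x\<in>S - {v}. w x *\<^sub>R x) = v" using s(2) v'(3) by simp
  then have "(\<Sum>x\<in>S - {v}. (- w x / w v) *\<^sub>R x) = v"
    by (simp add: scaleR_sum_right sum_negf)
  moreover have "(\<Sum>x\<in>S - {v}. - w x / w v) = 1"
    using s(1) v'(3) by (simp add: sum_negf flip: sum_divide_distrib)
  ultimately have "v \<in> affine hull (S - {v})"
    using finS by (auto simp: affine_hull_finite)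
  then have "aff_dim S = aff_dim (S - {v})"
    using aff_dim_insert[of v "S - {v}"] v'(1) by (simp add: insert_absorb)
  then show ?thesis
    using d True card_Diff_singleton[OF v'(1)] card_gt_0_iff[of S] finS v'(1)
    by (auto simp: aff_dim_convex_hull of_nat_diff)
qed

end

section \<open>Counting faces by complements and inclusion-exclusion\<close>

lemma card_subsets_avoiding:
  assumes "finite V" "X \<subseteq> V"
  shows "card {R. R \<subseteq> V \<and> R \<inter> X = {} \<and> card R = j} = (card V - card X) choose j"
proof -
  have "{R. R \<subseteq> V \<and> R \<inter> X = {} \<and> card R = j} = {R. R \<subseteq> V - X \<and> card R = j}" by blast
  then show ?thesis
    using assms n_subsets[of "V - X" j] by (simp add: card_Diff_subset finite_subset)
qed

lemma card_subsets_complement: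
  assumes "finite V" "\<And>S. S \<subseteq> V \<Longrightarrow> Q (V - S) \<longleftrightarrow> P S"
  shows "card {S. S \<subseteq> V \<and> P S} = card {R. R \<subseteq> V \<and> Q R}"
proof (rule bij_betw_same_card[of "\<lambda>S. V - S"], rule bij_betwI[where g = "\<lambda>R. V - R"])
  show "(\<lambda>R. V - R) \<in> {R. R \<subseteq> V \<and> Q R} \<rightarrow> {S. S \<subseteq> V \<and> P S}"
  proof (intro funcsetI, clarify)
    fix R assume "R \<subseteq> V" "Q R"
    then show "V - R \<subseteq> V \<and> P (V - R)" using assms(2)[of "V - R"] by (auto simp: double_diff)
  qed
qed (use assms(2) in \<open>auto simp: double_diff\<close>)

context affine_circuit
begin

lemma f_num_eq_card:
  "f_num k (convex hull V) =
     card {S. S \<subseteq> V \<and> \<not> Pos \<subseteq> S \<and> \<not> Neg \<subseteq> S \<and> card S = k + 1} +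
     card {S. S \<subseteq> V \<and> Pos \<union> Neg \<subseteq> S \<and> card S = k + 2}"
    (is "_ = card ?A + card ?B")
proof -
  have "{F. F face_of convex hull V \<and> aff_dim F = int k} =
      {F \<in> (\<lambda>S. convex hull S) ` face_sets. aff_dim F = int k}"
    using faces_eq by blast
  also have "\<dots> = (\<lambda>S. convex hull S) ` {S \<in> face_sets. aff_dim (convex hull S) = int k}"
    by blast
  also have "{S \<in> face_sets. aff_dim (convex hull S) = int k} = ?A \<union> ?B"
  proof (rule set_eqI)
    fix S
    show "S \<in> {S \<in> face_sets. aff_dim (convex hull S) = int k} \<longleftrightarrow> S \<in> ?A \<union> ?B"
    proof (cases "S \<in> face_sets")
      case True
      then have "S \<subseteq> V" "Pos \<subseteq> S \<longleftrightarrow> Neg \<subseteq> S" by (auto simp: face_sets_def)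
      then show ?thesis using True aff_dim_face[OF True] by (cases "Pos \<subseteq> S") auto
    next
      case False
      then show ?thesis by (auto simp: face_sets_def)
    qed
  qed
  finally have "f_num k (convex hull V) = card ((\<lambda>S. convex hull S) ` (?A \<union> ?B))"
    by (simp add: f_num_def)
  also have "\<dots> = card (?A \<union> ?B)"
    by (rule card_image) (rule inj_on_subset[OF inj_on_hull], auto simp: face_sets_def)
  also have "\<dots> = card ?A + card ?B"
    using finite_V by (intro card_Un_disjoint) auto
  finally show ?thesis .
qed

text \<open>The subtracted terms of inclusion-exclusion stand on the left to stay within the
  naturals. The \<open>+ 1\<close> in the last coefficient comes from Pascal's rule: it merges the
  term for sets avoiding both supports with the faces that contain both.\<close>

lemma f_num_formula:
  assumes k: "k + 2 \<le> card V"
  defines "j \<equiv> card V - (k + 1)"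
  shows "f_num k (convex hull V) + (card V - card Pos choose j) + (card V - card Neg choose j) =
    (card V choose j) + (card V - card Pos - card Neg + 1 choose j)"
proof -
  note fin = finite_V finite_subset[OF Pos_Neg_subset(1) finite_V]
    finite_subset[OF Pos_Neg_subset(2) finite_V]
  \<comment> \<open>The bound on \<open>k\<close> makes \<open>j\<close> positive. Faces containing
    both supports have \<open>k + 2\<close> points, hence complements of size \<open>i\<close>, one
    less than \<open>j\<close>.\<close>
  obtain i where i: "j = Suc i" using k unfolding j_def by (cases "card V - (k+1)") auto
  have co: "card (V - S) = j \<longleftrightarrow> card S = k + 1" "card (V - S) = i \<longleftrightarrow> card S = k + 2" if "S \<subseteq> V" for S
    using that k i card_mono[OF finite_V that] finite_subset[OF that finite_V]
    by (auto simp: card_Diff_subset j_def)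
  let ?U = "{R. R \<subseteq> V \<and> card R = j}"
  let ?M = "\<lambda>X. {R. R \<subseteq> V \<and> R \<inter> X = {} \<and> card R = j}"
  let ?H = "{R. R \<subseteq> V \<and> R \<inter> Pos \<noteq> {} \<and> R \<inter> Neg \<noteq> {} \<and> card R = j}"
  have avoid: "(V - S) \<inter> X = {} \<longleftrightarrow> X \<subseteq> S" if "X \<subseteq> V" for S X
    using that by blast
  have A: "card {S. S \<subseteq> V \<and> \<not> Pos \<subseteq> S \<and> \<not> Neg \<subseteq> S \<and> card S = k + 1} = card ?H"
    by (rule card_subsets_complement[OF finite_V])
      (simp add: avoid[OF Pos_Neg_subset(1)] avoid[OF Pos_Neg_subset(2)] co)
  have UV: "Pos \<union> Neg \<subseteq> V" using Pos_Neg_subset by simp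
  have "card {S. S \<subseteq> V \<and> Pos \<union> Neg \<subseteq> S \<and> card S = k + 2} =
      card {R. R \<subseteq> V \<and> R \<inter> (Pos \<union> Neg) = {} \<and> card R = i}"
    by (rule card_subsets_complement[OF finite_V]) (simp only: avoid[OF UV] co)
  moreover have cU: "card (Pos \<union> Neg) = card Pos + card Neg"
    using fin Pos_Neg_subset by (intro card_Un_disjoint) auto
  ultimately have B: "card {S. S \<subseteq> V \<and> Pos \<union> Neg \<subseteq> S \<and> card S = k + 2} =
      (card V - card Pos - card Neg choose i)"
    using card_subsets_avoiding[OF finite_V, of "Pos \<union> Neg" i] Pos_Neg_subset by auto
  have "?U = ?H \<union> (?M Pos \<union> ?M Neg)" by blast
  then have "card ?U = card ?H + card (?M Pos \<union> ?M Neg)"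
    using finite_V by (simp only:) (intro card_Un_disjoint, auto)
  moreover have "card (?M Pos) + card (?M Neg) = card (?M Pos \<union> ?M Neg) + card (?M Pos \<inter> ?M Neg)"
    using finite_V by (intro card_Un_Int) auto
  moreover have "?M Pos \<inter> ?M Neg = ?M (Pos \<union> Neg)" by blast
  ultimately have "card ?U + card (?M (Pos \<union> Neg)) = card ?H + card (?M Pos) + card (?M Neg)"
    by simp
  moreover have "card ?U = (card V choose j)" by (rule n_subsets[OF finite_V])
  moreover have "card (?M (Pos \<union> Neg)) = (card V - card Pos - card Neg choose j)"
    using card_subsets_avoiding[OF finite_V, of "Pos \<union> Neg" j] Pos_Neg_subset cU by auto
  moreover have "card (?M Pos) = (card V - card Pos choose j)"
    "card (?M Neg) = (card V - card Neg choose j)"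
    by (rule card_subsets_avoiding[OF finite_V] Pos_Neg_subset)+
  ultimately show ?thesis
    unfolding f_num_eq_card A B i by simp
qed

lemma aff_dim_hull: "aff_dim (convex hull V) = int (card V) - 2"
  using aff_dim_face[of V] Pos_Neg_subset by (simp add: face_sets_def)

end

section \<open>Combinatorial equivalence from equal support sizes\<close>

lemma comb_equivalent_hulls:
  assumes "affine_circuit V w" "affine_circuit V' w'"
    and "card V = card V'"
    and "card (pos_support V w) = card (pos_support V' w')"
    and "card (pos_support V (\<lambda>v. - w v)) = card (pos_support V' (\<lambda>v. - w' v))"
  shows "comb_equivalent (convex hull V) (convex hull V')"
proof -
  interpret C: affine_circuit V w by fact
  interpret C': affine_circuit V' w' by fact
  note fin = C.finite_V C'.finite_V finite_subset[OF C.Pos_Neg_subset(1) C.finite_V]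
    finite_subset[OF C.Pos_Neg_subset(2) C.finite_V]
    finite_subset[OF C'.Pos_Neg_subset(1) C'.finite_V]
    finite_subset[OF C'.Pos_Neg_subset(2) C'.finite_V]
  obtain f where f: "bij_betw f C.Pos C'.Pos"
    using finite_same_card_bij[OF fin(3,5) assms(4)] by blast
  obtain g where g: "bij_betw g C.Neg C'.Neg"
    using finite_same_card_bij[OF fin(4,6) assms(5)] by blast
  define Z Z' where "Z = V - (C.Pos \<union> C.Neg)" and "Z' = V' - (C'.Pos \<union> C'.Neg)"
  have "card Z = card Z'"
    unfolding Z_def Z'_def using fin assms C.Pos_Neg_subset C'.Pos_Neg_subset
    by (simp add: card_Diff_subset card_Un_disjoint)
  moreover have "finite Z" "finite Z'" using fin by (simp_all add: Z_def Z'_def)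
  ultimately obtain h where h: "bij_betw h Z Z'" using finite_same_card_bij by blast
  \<comment> \<open>Gluing bijections of the positive, negative and zero classes gives a bijection
    of the points that respects the face condition.\<close>
  define p where "p x = (if x \<in> C.Pos then f x else if x \<in> C.Neg then g x else h x)" for x
  have pP: "bij_betw p C.Pos C'.Pos" using f by (subst bij_betw_cong[of _ _ f]) (auto simp: p_def)
  have pN: "bij_betw p C.Neg C'.Neg"
    using g C.Pos_Neg_subset by (subst bij_betw_cong[of _ _ g]) (auto simp: p_def)
  have pZ: "bij_betw p Z Z'"
    using h by (subst bij_betw_cong[of _ _ h]) (auto simp: p_def Z_def)
  have "bij_betw p (C.Pos \<union> C.Neg \<union> Z) (C'.Pos \<union> C'.Neg \<union> Z')"
    by (intro bij_betw_combine pP pN pZ) (use C'.Pos_Neg_subset in \<open>auto simp: Z'_def\<close>)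
  moreover have "C.Pos \<union> C.Neg \<union> Z = V" "C'.Pos \<union> C'.Neg \<union> Z' = V'"
    using C.Pos_Neg_subset C'.Pos_Neg_subset by (auto simp: Z_def Z'_def)
  ultimately have p: "bij_betw p V V'" by simp
  have inj: "inj_on p V" and img: "p ` V = V'" using p by (auto simp: bij_betw_def)
  have imP: "p ` C.Pos = C'.Pos" and imN: "p ` C.Neg = C'.Neg"
    using pP pN by (auto simp: bij_betw_def)
  have sub: "p ` X \<subseteq> p ` S \<longleftrightarrow> X \<subseteq> S" if "X \<subseteq> V" "S \<subseteq> V" for X S
    using inj_on_image_subset_iff[OF inj that] .
  have "bij_betw ((`) p) C.face_sets C'.face_sets"
  proof (rule bij_betw_imageI)
    show "inj_on ((`) p) C.face_sets"
      by (rule inj_on_subset[OF inj_on_image_Pow[OF inj]]) (auto simp: C.face_sets_def)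
    have mem: "(p ` S \<in> C'.face_sets) = (S \<in> C.face_sets)" if "S \<subseteq> V" for S
      using sub[OF C.Pos_Neg_subset(1) that] sub[OF C.Pos_Neg_subset(2) that] that img imP imN
      by (auto simp: C.face_sets_def C'.face_sets_def)
    show "(`) p ` C.face_sets = C'.face_sets"
    proof (intro equalityI subsetI)
      fix T assume "T \<in> (`) p ` C.face_sets"
      then obtain S where "S \<in> C.face_sets" "T = p ` S" by blast
      then show "T \<in> C'.face_sets" using mem[of S] by (simp add: C.face_sets_def)
    next
      fix T assume T: "T \<in> C'.face_sets"
      then have "T \<subseteq> p ` V" using img by (simp add: C'.face_sets_def)
      then obtain S where S: "S \<subseteq> V" "T = p ` S" by (meson subset_imageE)
      then have "S \<in> C.face_sets" using mem[OF S(1)] T by simp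
      then show "T \<in> (`) p ` C.face_sets" using S(2) by (rule rev_image_eqI)
    qed
  qed
  moreover have "bij_betw (\<lambda>F. V \<inter> F) {F. F face_of convex hull V} C.face_sets"
    unfolding C.faces_eq
    by (rule bij_betwI[where g = "\<lambda>S. convex hull S"]) (auto simp: C.face_sets_vertices)
  moreover have "bij_betw (\<lambda>S. convex hull S) C'.face_sets {F. F face_of convex hull V'}"
    unfolding C'.faces_eq by (rule inj_on_imp_bij_betw[OF C'.inj_on_hull])
  \<comment> \<open>A face is sent to its points in \<open>V\<close>, these are moved by
    \<open>p\<close>, and the hull is taken again.\<close>
  ultimately have bij: "bij_betw ((\<lambda>S. convex hull S) \<circ> ((`) p \<circ> (\<lambda>F. V \<inter> F)))
      {F. F face_of convex hull V} {F. F face_of convex hull V'}"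
    by (intro bij_betw_trans)
  show ?thesis
    unfolding comb_equivalent_def
  proof (intro exI conjI allI impI, rule bij)
    fix F G assume "F face_of convex hull V" "G face_of convex hull V"
    then have "F \<in> (\<lambda>S. convex hull S) ` C.face_sets" "G \<in> (\<lambda>S. convex hull S) ` C.face_sets"
      unfolding C.faces_eq[symmetric] by simp_all
    then obtain S T where S: "S \<in> C.face_sets" "F = convex hull S"
      and T: "T \<in> C.face_sets" "G = convex hull T" by blast
    have mem: "p ` S \<in> C'.face_sets" "p ` T \<in> C'.face_sets"
      using \<open>bij_betw ((`) p) C.face_sets C'.face_sets\<close> S T by (auto simp: bij_betw_def)
    show "F \<subseteq> G \<longleftrightarrow> ((\<lambda>S. convex hull S) \<circ> ((`) p \<circ> (\<lambda>F. V \<inter> F))) F \<subseteq>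
        ((\<lambda>S. convex hull S) \<circ> ((`) p \<circ> (\<lambda>F. V \<inter> F))) G"
      using S T sub[of S T]
      by (simp add: C.face_sets_vertices C.hull_subset_iff C'.hull_subset_iff[OF mem])
        (auto simp: C.face_sets_def)
  qed
qed

section \<open>Circuits of pyramids and free sums\<close>

lemma affine_circuit_insert:
  assumes "affine_circuit V w" "x \<notin> affine hull V"
  shows "affine_circuit (insert x V) (w(x := 0))"
proof -
  interpret affine_circuit V w by fact
  have x: "x \<notin> V" using assms(2) hull_inc[of x V affine] by blast
  have eq: "(\<Sum>v\<in>V. (w(x := 0)) v) = sum w V"
    "(\<Sum>v\<in>V. (w(x := 0)) v *\<^sub>R v) = (\<Sum>v\<in>V. w v *\<^sub>R v)"
    using x by (auto intro!: sum.cong)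
  show ?thesis
  proof
    fix c assume c: "sum c (insert x V) = 0" "(\<Sum>v\<in>insert x V. c v *\<^sub>R v) = 0"
    then have c1: "sum c V = - c x" and c2: "(\<Sum>v\<in>V. c v *\<^sub>R v) = - c x *\<^sub>R x"
      using x finite_V by (auto simp: add_eq_0_iff)
    \<comment> \<open>A nonzero coefficient at the apex would write \<open>x\<close> as an affine
      combination of \<open>V\<close>.\<close>
    have cx: "c x = 0"
    proof (rule ccontr)
      assume nz: "c x \<noteq> 0"
      have "(- 1 / c x) *\<^sub>R (\<Sum>v\<in>V. c v *\<^sub>R v) = x" using c2 nz by simp
      then have "(\<Sum>v\<in>V. (- c v / c x) *\<^sub>R v) = x" by (simp add: scaleR_sum_right sum_negf)
      moreover have "(\<Sum>v\<in>V. - c v / c x) = 1"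
        using c1 nz by (simp add: sum_negf flip: sum_divide_distrib)
      ultimately have "x \<in> affine hull V" using finite_V by (auto simp: affine_hull_finite)
      then show False using assms(2) by blast
    qed
    then obtain t where "\<forall>v\<in>V. c v = t * w v" using c1 c2 dependency_unique by auto
    then have "\<forall>v\<in>insert x V. c v = t * (w(x := 0)) v" using cx by auto
    then show "\<exists>t. \<forall>v\<in>insert x V. c v = t * (w(x := 0)) v" by blast
  qed (use x finite_V sum_w comb_w nontrivial eq in auto)
qed

lemma iterated_pyramid_circuit:
  assumes "iterated_pyramid r B P" "B = convex hull V" "affine_circuit V w"
  shows "\<exists>V' w'. affine_circuit V' w' \<and> P = convex hull V' \<and> card V' = card V + r \<and>
    pos_support V' w' = pos_support V w \<and>
    pos_support V' (\<lambda>v. - w' v) = pos_support V (\<lambda>v. - w v)"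
  using assms
proof (induction rule: iterated_pyramid.induct)
  case (base B)
  then show ?case by auto
next
  case (apex r B P x)
  then obtain V' w' where V': "affine_circuit V' w'" "P = convex hull V'" "card V' = card V + r"
    "pos_support V' w' = pos_support V w"
    "pos_support V' (\<lambda>v. - w' v) = pos_support V (\<lambda>v. - w v)"
    by blast
  have x: "x \<notin> affine hull V'" using apex.hyps V'(2) by simp
  then have xV: "x \<notin> V'" using hull_inc by metis
  let ?w = "w'(x := 0)"
  have "affine_circuit (insert x V') ?w" using affine_circuit_insert V'(1) x by blast
  moreover have "convex hull (insert x P) = convex hull (insert x V')"
    using V'(2) hull_insert by metis
  moreover have "card (insert x V') = card V + Suc r"
    using V'(3) xV affine_circuit.finite_V[OF V'(1)] by simp
  moreover have "pos_support (insert x V') ?w = pos_support V' w'"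
    "pos_support (insert x V') (\<lambda>v. - ?w v) = pos_support V' (\<lambda>v. - w' v)"
    using xV by (auto simp: pos_support_def)
  ultimately show ?case using V'(4,5) by metis
qed

text \<open>If 0 were in \<open>A\<close>, subtracting the unit weight at 0 from a positive
  representation of 0 would give a dependency. It must vanish, although it is positive at every
  other point of \<open>A\<close>.\<close>

lemma zero_notin_affine_basis:
  fixes A :: "'a::euclidean_space set"
  assumes "\<not> affine_dependent A" "0 \<in> rel_interior (convex hull A)" "2 \<le> card A"
  shows "0 \<notin> A"
proof
  assume "0 \<in> A"
  have fin: "finite A" using assms(1) by (rule aff_independent_finite)
  obtain u where u: "\<forall>x\<in>A. 0 < u x" "sum u A = 1" "(\<Sum>x\<in>A. u x *\<^sub>R x) = 0"
    using assms(2) by (auto simp: rel_interior_convex_hull_explicit[OF assms(1)])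
  define c where "c x = u x - (if x = 0 then 1 else 0)" for x
  have "sum c A = 0" using u(2) fin \<open>0 \<in> A\<close> by (simp add: c_def sum_subtractf)
  moreover have "(\<Sum>x\<in>A. c x *\<^sub>R x) = (\<Sum>x\<in>A. u x *\<^sub>R x)"
    by (intro sum.cong) (auto simp: c_def)
  ultimately have c0: "\<forall>x\<in>A. c x = 0"
    using assms(1) u(3) by (auto simp: affine_dependent_explicit_finite[OF fin])
  have "A \<subseteq> {0}"
  proof
    fix x assume "x \<in> A"
    then show "x \<in> {0}" using c0 u(1) by (force simp: c_def split: if_splits)
  qed
  then have "card A \<le> 1" using card_mono[of "{0}" A] by simp
  then show False using assms(3) by simp
qed

lemma free_sum_hulls:
  "free_sum (convex hull A) (convex hull B) =
     convex hull ((\<lambda>x. (x, 0)) ` A \<union> (\<lambda>y. (0, y)) ` B)"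
proof -
  have "linear (\<lambda>x::'a. (x, 0::'b))" "linear (\<lambda>y::'b. (0::'a, y))"
    by (auto intro!: linearI)
  then show ?thesis
    unfolding free_sum_def
    by (simp add: convex_hull_linear_image flip: hull_Un_left hull_Un_right)
qed

text \<open>Both factors represent the origin with positive coefficients. The coefficients on
  \<open>A\<close> minus those on \<open>B\<close> form the dependency.\<close>

lemma free_sum_circuit:
  fixes A :: "'a::euclidean_space set" and B :: "'b::euclidean_space set"
  assumes A: "\<not> affine_dependent A" "0 \<in> rel_interior (convex hull A)"
    and B: "\<not> affine_dependent B" "0 \<in> rel_interior (convex hull B)" "2 \<le> card B"
  defines "V \<equiv> (\<lambda>x. (x, 0)) ` A \<union> (\<lambda>y. (0, y)) ` B"
  shows "\<exists>w. affine_circuit V w \<and> card V = card A + card B \<and>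
    card (pos_support V w) = card A \<and> card (pos_support V (\<lambda>v. - w v)) = card B"
proof -
  have fin: "finite A" "finite B" using A B aff_independent_finite by blast+
  have B0: "0 \<notin> B" using zero_notin_affine_basis[OF B] .
  obtain \<alpha> where \<alpha>: "\<forall>x\<in>A. 0 < \<alpha> x" "sum \<alpha> A = 1" "(\<Sum>x\<in>A. \<alpha> x *\<^sub>R x) = 0"
    using A(2) by (auto simp: rel_interior_convex_hull_explicit[OF A(1)])
  obtain \<beta> where \<beta>: "\<forall>x\<in>B. 0 < \<beta> x" "sum \<beta> B = 1" "(\<Sum>x\<in>B. \<beta> x *\<^sub>R x) = 0"
    using B(2) by (auto simp: rel_interior_convex_hull_explicit[OF B(1)])
  \<comment> \<open>Testing \<open>y = 0\<close> separates the two copies, since 0 is not in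
    \<open>B\<close>.\<close>
  define w where "w = (\<lambda>(x::'a, y::'b). if y = 0 then \<alpha> x else - \<beta> y)"
  let ?iA = "\<lambda>x::'a. (x, 0::'b)" and ?iB = "\<lambda>y::'b. (0::'a, y)"
  have inj: "inj_on ?iA A" "inj_on ?iB B" by (auto intro: inj_onI)
  have disj: "?iA ` A \<inter> ?iB ` B = {}" using B0 by auto
  have sumV: "sum f V = (\<Sum>x\<in>A. f (x, 0)) + (\<Sum>y\<in>B. f (0, y))" for f :: "'a \<times> 'b \<Rightarrow> 'c::real_vector"
    unfolding V_def using fin disj inj
    by (simp add: sum.union_disjoint sum.reindex)
  have wA: "w (x, 0) = \<alpha> x" for x by (simp add: w_def)
  have wB: "w (0, y) = - \<beta> y" if "y \<in> B" for y using that B0 by (auto simp: w_def)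
  have comb: "(\<Sum>v\<in>V. c v *\<^sub>R v) = (\<Sum>x\<in>A. c (x, 0) *\<^sub>R x, \<Sum>y\<in>B. c (0, y) *\<^sub>R y)" for c
    unfolding sumV by (simp add: prod_eq_iff fst_sum snd_sum)
  have "A \<noteq> {}" using \<alpha>(2) by auto
  then obtain a0 where a0: "a0 \<in> A" by blast
  have sup: "pos_support V w = ?iA ` A" "pos_support V (\<lambda>v. - w v) = ?iB ` B"
    using \<alpha>(1) \<beta>(1) wA wB B0 by (auto simp: pos_support_def V_def)
  have "affine_circuit V w"
  proof
    show "finite V" using fin by (simp add: V_def)
    show "sum w V = 0" unfolding sumV using \<alpha>(2) \<beta>(2) wA wB by (simp add: sum_negf)
    show "(\<Sum>v\<in>V. w v *\<^sub>R v) = 0"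
      unfolding comb using \<alpha>(3) \<beta>(3) wA wB by (simp add: sum_negf zero_prod_def)
    show "\<exists>v\<in>V. w v \<noteq> 0"
      using a0 \<alpha>(1) wA[of a0] by (intro bexI[of _ "(a0, 0)"]) (auto simp: V_def)
  next
    fix c assume c: "sum c V = 0" "(\<Sum>v\<in>V. c v *\<^sub>R v) = 0"
    \<comment> \<open>As \<open>\<alpha>\<close> sums to 1, this total is the only candidate for the
      multiple. Subtracting \<open>t * w\<close> leaves separate dependencies on \<open>A\<close>
      and on \<open>B\<close>, and both vanish by independence.\<close>
    define t where "t = (\<Sum>x\<in>A. c (x, 0))"
    have tB: "(\<Sum>y\<in>B. c (0, y)) = - t" using c(1) by (simp add: sumV t_def)
    have cA: "(\<Sum>x\<in>A. c (x, 0) *\<^sub>R x) = 0" and cB: "(\<Sum>y\<in>B. c (0, y) *\<^sub>R y) = 0"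
      using c(2) unfolding comb by (auto simp: zero_prod_def)
    have "(\<Sum>x\<in>A. c (x, 0) - t * \<alpha> x) = 0"
      using \<alpha>(2) by (simp add: sum_subtractf t_def flip: sum_distrib_left)
    moreover have "(\<Sum>x\<in>A. (c (x, 0) - t * \<alpha> x) *\<^sub>R x) = 0"
      using cA \<alpha>(3) by (simp add: scaleR_diff_left sum_subtractf flip: scaleR_scaleR scaleR_sum_right)
    ultimately have eA: "\<forall>x\<in>A. c (x, 0) - t * \<alpha> x = 0"
      using A(1) unfolding affine_dependent_explicit_finite[OF fin(1)] by blast
    have "(\<Sum>y\<in>B. c (0, y) + t * \<beta> y) = 0"
      using \<beta>(2) tB by (simp add: sum.distrib flip: sum_distrib_left)
    moreover have "(\<Sum>y\<in>B. (c (0, y) + t * \<beta> y) *\<^sub>R y) = 0"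
      using cB \<beta>(3) by (simp add: scaleR_add_left sum.distrib flip: scaleR_scaleR scaleR_sum_right)
    ultimately have eB: "\<forall>y\<in>B. c (0, y) + t * \<beta> y = 0"
      using B(1) unfolding affine_dependent_explicit_finite[OF fin(2)] by blast
    have "\<forall>v\<in>V. c v = t * w v"
      using eA eB wA wB by (auto simp: V_def)
    then show "\<exists>t. \<forall>v\<in>V. c v = t * w v" by blast
  qed
  moreover have "card V = card A + card B"
    unfolding V_def using fin disj inj by (simp add: card_Un_disjoint card_image)
  ultimately show ?thesis using sup inj card_image by metis
qed

text \<open>The bridge from geometry to counting: later facts about \<open>T_polytope\<close> are
  read off from this circuit. The apexes account for the remaining \<open>d - a\<close>
  points.\<close>

lemma T_polytope_circuit:
  assumes "T_polytope d a m P" "m < a" "a \<le> d"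
  obtains V w where "affine_circuit V w" "P = convex hull V" "card V = d + 2"
    "card (pos_support V w) = m + 1" "card (pos_support V (\<lambda>v. - w v)) = a - m + 1"
proof -
  obtain Q :: "'a set" and Q' :: "'b set" where Q: "int m simplex Q" "int (a - m) simplex Q'"
    "0 \<in> rel_interior Q" "0 \<in> rel_interior Q'" "iterated_pyramid (d - a) (free_sum Q Q') P"
    using assms(1) unfolding T_polytope_def by blast
  obtain A where A: "\<not> affine_dependent A" "int (card A) = int m + 1" "Q = convex hull A"
    using Q(1) unfolding simplex_def by blast
  obtain B where B: "\<not> affine_dependent B" "int (card B) = int (a - m) + 1" "Q' = convex hull B"
    using Q(2) unfolding simplex_def by blast
  define V where "V = (\<lambda>x. (x, 0::'b)) ` A \<union> (\<lambda>y. (0::'a, y)) ` B"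
  have "2 \<le> card B" using B(2) assms(2) by linarith
  then obtain w where w: "affine_circuit V w" "card V = card A + card B"
    "card (pos_support V w) = card A" "card (pos_support V (\<lambda>v. - w v)) = card B"
    using free_sum_circuit[of A B] A B Q unfolding V_def by blast
  have "free_sum Q Q' = convex hull V" unfolding V_def A B by (rule free_sum_hulls)
  then obtain V' w' where V': "affine_circuit V' w'" "P = convex hull V'"
    "card V' = card V + (d - a)" "pos_support V' w' = pos_support V w"
    "pos_support V' (\<lambda>v. - w' v) = pos_support V (\<lambda>v. - w v)"
    using iterated_pyramid_circuit[OF Q(5) _ w(1)] by blast
  show thesis
  proof (rule that[OF V'(1,2)])
    show "card V' = d + 2" using V'(3) w(2) A(2) B(2) assms by linarith
  qed (use V' w A B in auto)
qed

lemma T_polytope_f_num: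
  assumes "T_polytope d a m P" "m < a" "a \<le> d" "k \<le> d"
  shows "f_num k P + (d + 1 - m choose (d + 1 - k)) + (d + 1 - (a - m) choose (d + 1 - k)) =
    (d + 2 choose (d + 1 - k)) + (d + 1 - a choose (d + 1 - k))"
proof -
  obtain V w where V: "affine_circuit V w" "P = convex hull V" "card V = d + 2"
    "card (pos_support V w) = m + 1" "card (pos_support V (\<lambda>v. - w v)) = a - m + 1"
    using T_polytope_circuit[OF assms(1-3)] by blast
  have "d + 2 - (k + 1) = d + 1 - k" "d + 2 - (m + 1) = d + 1 - m"
    "d + 2 - (a - m + 1) = d + 1 - (a - m)" "d + 1 - m - (a - m + 1) + 1 = d + 1 - a"
    using assms by auto
  then show ?thesis
    using affine_circuit.f_num_formula[OF V(1), of k] V assms(4) by simp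
qed

lemma T_polytope_facets:
  assumes "T_polytope d a m P" "m < a" "a \<le> d"
  shows "card {F. F facet_of P} = d + 1 + m * (a - m)"
proof -
  obtain V w where V: "affine_circuit V w" "P = convex hull V" "card V = d + 2"
    using T_polytope_circuit[OF assms] by blast
  have dim: "aff_dim P = int d" using affine_circuit.aff_dim_hull[OF V(1)] V by simp
  have "{F. F facet_of P} = {F. F face_of P \<and> aff_dim F = int (d - 1)}"
    using dim assms by (auto simp: facet_of_def of_nat_diff)
  then have c: "card {F. F facet_of P} = f_num (d - 1) P" by (simp add: f_num_def)
  define b e where "b = a - m" and "e = d - a"
  have d: "d = m + b + e" and a: "a = m + b" using assms by (auto simp: b_def e_def)
  have two: "d + 1 - (d - 1) = 2" using assms by simp
  \<comment> \<open>Doubling turns the binomial coefficients into integer polynomials, so the facet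
    count becomes a polynomial identity.\<close>
  have choose: "int (x choose 2) * 2 = int x * (int x - 1)" for x :: nat
    by (induction x) (simp_all add: numeral_2_eq_2 algebra_simps)
  have "f_num (d - 1) P + (b + e + 1 choose 2) + (m + e + 1 choose 2) =
      (m + b + e + 2 choose 2) + (e + 1 choose 2)"
    using T_polytope_f_num[OF assms, of "d - 1"] unfolding two by (simp add: d a)
  then have "2 * int (f_num (d - 1) P) + int (b + e + 1 choose 2) * 2 + int (m + e + 1 choose 2) * 2 =
      int (m + b + e + 2 choose 2) * 2 + int (e + 1 choose 2) * 2"
    by linarith
  then have "2 * int (f_num (d - 1) P) = 2 * int (d + 1 + m * b)"
    unfolding choose d by (simp add: algebra_simps)
  then have "int (f_num (d - 1) P) = int (d + 1 + m * b)"
    by (simp only: mult_cancel_left) simp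
  then show ?thesis unfolding c b_def of_nat_eq_iff .
qed

section \<open>Convexity inequalities for binomial coefficients\<close>

text \<open>Pascal's rule under truncated subtraction; at \<open>x = 0\<close> the second summand
  has to be dropped.\<close>

lemma binomial_diff_pred:
  "x choose Suc s = (x - 1 choose Suc s) + (if x = 0 then 0 else x - 1 choose s)"
  by (cases x) auto

text \<open>The drop over a shift by \<open>q\<close> grows with the starting point: each unit step
  loses a coefficient with lower index \<open>s\<close>, which is monotone in the upper
  index.\<close>

lemma binomial_shift_convex:
  assumes "y \<le> x"
  shows "(y choose Suc s) + (x - q choose Suc s) \<le> (x choose Suc s) + (y - q choose Suc s)"
proof (induction q)
  case (Suc q)
  have "y - q - 1 choose s \<le> (x - q - 1 choose s)" if "y - q \<noteq> 0"
    using assms by (intro binomial_right_mono) auto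
  then show ?case
    using Suc binomial_diff_pred[of "x - q" s] binomial_diff_pred[of "y - q" s] assms
    by (auto split: if_splits)
qed simp

lemma binomial_strict_right_mono:
  assumes "y < x" "1 \<le> s" "s \<le> x"
  shows "(y choose s) < (x choose s)"
proof -
  obtain z t where z: "x = Suc z" "s = Suc t" using assms by (cases x; cases s) auto
  have "(y choose s) \<le> (z choose s)" using assms z by (intro binomial_right_mono) auto
  moreover have "0 < (z choose t)" using assms z by simp
  ultimately show ?thesis unfolding z binomial_Suc_Suc by linarith
qed

text \<open>The first unit step is strict, and the weak inequality handles the remaining
  \<open>q - 1\<close> steps.\<close>

lemma binomial_shift_strict_convex:
  assumes "y < x" "1 \<le> q" "1 \<le> s" "Suc s \<le> x"
  shows "(y choose Suc s) + (x - q choose Suc s) < (x choose Suc s) + (y - q choose Suc s)"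
proof -
  obtain q' where q: "q = Suc q'" using assms by (cases q) auto
  have "(if y = 0 then 0 else y - 1 choose s) < (x - 1 choose s)"
    using assms binomial_strict_right_mono[of "y - 1" "x - 1" s] by auto
  moreover have "(y - 1 choose Suc s) + (x - 1 - q' choose Suc s) \<le>
      (x - 1 choose Suc s) + (y - 1 - q' choose Suc s)"
    using assms by (intro binomial_shift_convex) auto
  ultimately show ?thesis
    using binomial_diff_pred[of x s] binomial_diff_pred[of y s] assms(1) q by (auto split: if_splits)
qed

text \<open>Part (ii) with \<open>n = d + 1\<close>, \<open>p = m\<close>, \<open>q = a - m\<close>,
  \<open>s = d - k - 1\<close> and \<open>l\<close> at its largest value \<open>1 + p * q\<close>.
  Strictness comes from the base case \<open>p = 2\<close>.\<close>

lemma binomial_circuit_less: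
  assumes "2 \<le> p" "2 \<le> q" "p + q < n" "1 \<le> s" "s + 3 \<le> n"
  shows "(n - p choose (s + 2)) + (n - q choose (s + 2)) <
    (n - p - q choose (s + 2)) + (n - 1 choose (s + 2)) + (n - 1 - p * q choose (s + 1))"
  using assms(1,3)
proof (induction p rule: dec_induct)
  case base
  \<comment> \<open>Three uses of Pascal's rule reduce the base case to this inequality;
    \<open>q \<ge> 2\<close> makes \<open>n - 1 - q\<close> smaller than
    \<open>n - 2\<close>.\<close>
  have "(n - 1 - q choose Suc s) + (n - 2 - q choose Suc s) <
      (n - 2 choose Suc s) + (n - 1 - q - q choose Suc s)"
    using assms(2,4,5) by (intro binomial_shift_strict_convex) auto
  moreover have "n - q \<noteq> 0" "n - 1 \<noteq> 0" "n - 1 - q \<noteq> 0" using base by auto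
  moreover have "n - q - 1 = n - 1 - q" "n - 1 - 1 = n - 2" "n - 1 - q - 1 = n - 2 - q"
    "n - 1 - 2 * q = n - 1 - q - q" by auto
  ultimately show ?case
    using binomial_diff_pred[of "n - q" "Suc s"] binomial_diff_pred[of "n - 1" "Suc s"]
      binomial_diff_pred[of "n - 1 - q" "Suc s"]
    by simp
next
  case (step p)
  \<comment> \<open>Raising \<open>p\<close> by one lowers both sides. Convexity, starting from
    these two arguments, shows that the right side drops by no more than the left.\<close>
  have "n - 1 - p * q \<le> n - 1 - p" using assms(2) by (intro diff_le_mono2) simp
  then have "(n - 1 - p * q choose Suc s) + (n - 1 - p - q choose Suc s) \<le>
      (n - 1 - p choose Suc s) + (n - 1 - p * q - q choose Suc s)"
    by (rule binomial_shift_convex)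
  moreover have "n - p \<noteq> 0" "n - p - q \<noteq> 0" using step by auto
  moreover have "n - p - 1 = n - Suc p" "n - p - q - 1 = n - Suc p - q" "n - 1 - p = n - Suc p"
    "n - 1 - Suc p * q = n - 1 - p * q - q" by auto
  ultimately show ?case
    using binomial_diff_pred[of "n - p" "Suc s"] binomial_diff_pred[of "n - p - q" "Suc s"] step
    by simp
qed

section \<open>Comparison of the face numbers\<close>

text \<open>For \<open>m = 1\<close> two terms of the general formula merge by Pascal's rule, so
  that \<open>l\<close> enters through a single binomial coefficient.\<close>

lemma T_polytope_1_f_num:
  assumes "T_polytope d l 1 S" "2 \<le> l" "l \<le> d" "k \<le> d"
  shows "f_num k S + (d choose (d + 1 - k)) + (d + 1 - l choose (d - k)) =
    (d + 2 choose (d + 1 - k))"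
proof -
  have "d + 1 - (l - 1) \<noteq> 0" "d + 1 - (l - 1) - 1 = d + 1 - l" "Suc (d - k) = d + 1 - k"
    using assms by auto
  then show ?thesis
    using T_polytope_f_num[OF assms(1) _ assms(3,4)] assms(2)
      binomial_diff_pred[of "d + 1 - (l - 1)" "d - k"] by simp
qed

theorem theorem3p2:
  fixes d l a m :: nat
    and P :: "('p::euclidean_space \<times> 'q::euclidean_space) set"
    and S :: "('r::euclidean_space \<times> 's::euclidean_space) set"
  assumes "3 \<le> d" and "2 \<le> l" and "l \<le> d" and "2 \<le> a" and "a \<le> d"
    and "1 \<le> m" and "m \<le> a div 2"
    and "T_polytope d a m P"
    and "T_polytope d l 1 S"
    and "card {F. F facet_of P} \<ge> d + l"
    and "\<not> comb_equivalent P S"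
  shows "(m = 1 \<longrightarrow> (\<forall>k. l - 1 \<le> k \<and> k \<le> d - 1 \<longrightarrow> f_num k P > f_num k S)) \<and>
         (m \<ge> 2 \<longrightarrow> (\<forall>k\<in>{1..d - 2}. f_num k P > f_num k S))"
proof -
  have ma: "m < a" using assms by auto
  have la: "l \<le> 1 + m * (a - m)"
    using T_polytope_facets[OF assms(8) ma assms(5)] assms(10) by simp
  note S_count = T_polytope_1_f_num[OF assms(9,2,3)]
  show ?thesis
  proof (intro conjI impI allI ballI)
    fix k assume m: "m = 1" and k: "l - 1 \<le> k \<and> k \<le> d - 1"
    \<comment> \<open>With \<open>a = l\<close> both polytopes would have equally large supports and
      hence be combinatorially equivalent.\<close>
    have "a \<noteq> l"
    proof
      assume "a = l"
      obtain V w where V: "affine_circuit V w" "P = convex hull V" "card V = d + 2"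
        "card (pos_support V w) = m + 1" "card (pos_support V (\<lambda>v. - w v)) = a - m + 1"
        using T_polytope_circuit[OF assms(8) ma assms(5)] by blast
      obtain V' w' where V': "affine_circuit V' w'" "S = convex hull V'" "card V' = d + 2"
        "card (pos_support V' w') = 1 + 1" "card (pos_support V' (\<lambda>v. - w' v)) = l - 1 + 1"
        using T_polytope_circuit[OF assms(9) _ assms(3)] assms(2) by auto
      have "comb_equivalent P S"
        unfolding V(2) V'(2)
        by (rule comb_equivalent_hulls[OF V(1) V'(1)]) (simp_all add: V V' m \<open>a = l\<close>)
      then show False using assms(11) by simp
    qed
    then have "l < a" using la m assms by simp
    \<comment> \<open>Here \<open>k \<ge> l - 1\<close> means \<open>d - k \<le> d + 1 - l\<close>,
      so the larger coefficient is nonzero and the inequality strict.\<close>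
    then have "(d + 1 - a choose (d - k)) < (d + 1 - l choose (d - k))"
      using k assms by (intro binomial_strict_right_mono) auto
    moreover have "f_num k P + (d choose (d + 1 - k)) + (d + 1 - a choose (d - k)) =
        (d + 2 choose (d + 1 - k))"
      using T_polytope_1_f_num[OF _ assms(4,5), of P k] assms(8) m k by fastforce
    ultimately show "f_num k S < f_num k P" using S_count[of k] k by linarith
  next
    fix k assume m: "2 \<le> m" and k: "k \<in> {1..d - 2}"
    \<comment> \<open>The bound \<open>k \<le> d - 2\<close> gives \<open>s \<ge> 1\<close>, and
      \<open>k \<ge> 1\<close> gives \<open>s + 3 \<le> d + 1\<close>.\<close>
    define s where "s = d - k - 1"
    have s: "d + 1 - k = s + 2" "d - k = s + 1" "1 \<le> s" "s + 3 \<le> d + 1"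
      using k assms(1) by (auto simp: s_def)
    have "m * 2 \<le> a" using assms(7) by linarith
    then have am: "2 \<le> a - m" "m + (a - m) < d + 1" "d + 1 - m - (a - m) = d + 1 - a"
      using m assms(5) by auto
    \<comment> \<open>The facet bound on \<open>l\<close> reduces the claim to the extreme value
      \<open>1 + m * (a - m)\<close>.\<close>
    have "(d + 1 - 1 - m * (a - m) choose (s + 1)) \<le> (d + 1 - l choose (s + 1))"
      using la assms(3) by (intro binomial_right_mono) linarith
    then have "(d + 1 - m choose (s + 2)) + (d + 1 - (a - m) choose (s + 2)) <
        (d + 1 - a choose (s + 2)) + (d choose (s + 2)) + (d + 1 - l choose (s + 1))"
      using binomial_circuit_less[OF m am(1,2) s(3,4)] am(3) by simp
    moreover have "k \<le> d" using k by auto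
    ultimately show "f_num k S < f_num k P"
      using T_polytope_f_num[OF assms(8) ma assms(5), of k] S_count[of k] unfolding s by linarith
  qed
qed

end
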